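(* Let $n\in\mathbb{N}^*$ and $d\in\mathbb{N}$. Then $\mathcal{D}\text{-}\mathcal{SOS}_n$ and $\mathcal{DC}\text{-}\mathcal{SOS}_n$ are vector subspaces of $\mathbb{R}[x]$, and $\mathcal{D}\text{-}\mathcal{SOS}_{n,d}$ and $\mathcal{DC}\text{-}\mathcal{SOS}_{n,d}$ are vector subspaces of $\mathbb{R}_d[x]$.
   Context: $\mathbb{N}^*=\mathbb{N}\setminus\{0\}$. $\mathbb{R}[x]$ is the space of real polynomials in $x\in\mathbb{R}^n$, and $\mathbb{R}_d[x]$ its subspace of polynomials of degree at most $d$. A polynomial is SOS if it is a finite sum of squares of polynomials, and CSOS if it is both convex on $\mathbb{R}^n$ and SOS. A polynomial $p$ is D-SOS (resp. DC-SOS) if $p=s_1-s_2$ with $s_1,s_2$ SOS (resp. CSOS) polynomials. $\mathcal{D}\text{-}\mathcal{SOS}_n$ (resp. $\mathcal{DC}\text{-}\mathcal{SOS}_n$) is the set of D-SOS (resp. DC-SOS) polynomials in $\mathbb{R}[x]$, and $\mathcal{D}\text{-}\mathcal{SOS}_{n,d}$ (resp. $\mathcal{DC}\text{-}\mathcal{SOS}_{n,d}$) is its intersection with $\mathbb{R}_d[x]$. *)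

theory Defs
  imports "HOL-Analysis.Analysis" "HOL-Library.Poly_Mapping"
begin

text \<open>
  The polynomials in the variables indexed by the finite type \<open>'n\<close>: finitely supported maps from
  exponent vectors to real coefficients, with the ring structure of the library (convolution).
  Since types are nonempty, \<open>CARD('n)\<close> plays the role of a positive number of variables.
\<close>

type_synonym 'n rpoly = "('n \<Rightarrow>\<^sub>0 nat) \<Rightarrow>\<^sub>0 real"

text \<open>The coefficientwise real vector space structure, which the library does not provide.\<close>

instantiation poly_mapping :: (type, real_vector) real_vector
begin

definition scaleR_poly_mapping :: "real \<Rightarrow> ('a \<Rightarrow>\<^sub>0 'b) \<Rightarrow> ('a \<Rightarrow>\<^sub>0 'b)"
  where "scaleR_poly_mapping c p = Poly_Mapping.map (scaleR c) p"

lemma lookup_scaleR: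
  "Poly_Mapping.lookup (c *\<^sub>R p) m = c *\<^sub>R Poly_Mapping.lookup p m"
  for p :: "'a \<Rightarrow>\<^sub>0 'b"
  by (simp add: scaleR_poly_mapping_def Poly_Mapping.map.rep_eq when_def)

instance
  by standard
    (auto intro!: poly_mapping_eqI simp: lookup_scaleR lookup_add scaleR_add_right scaleR_add_left)

end

definition eval :: "'n::finite rpoly \<Rightarrow> real ^ 'n \<Rightarrow> real"
  where "eval p x =
    (\<Sum>m\<in>Poly_Mapping.keys p.
       Poly_Mapping.lookup p m * (\<Prod>i\<in>UNIV. x $ i ^ Poly_Mapping.lookup m i))"

text \<open>The zero polynomial has no monomials, so it belongs to \<open>polys_upto d\<close> for every \<open>d\<close>.\<close>

definition polys_upto :: "nat \<Rightarrow> 'n::finite rpoly set"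
  where "polys_upto d =
    {p. \<forall>m\<in>Poly_Mapping.keys p. (\<Sum>i\<in>UNIV. Poly_Mapping.lookup m i) \<le> d}"

definition SOS :: "'n::finite rpoly \<Rightarrow> bool"
  where "SOS p \<longleftrightarrow> (\<exists>qs. p = (\<Sum>q\<leftarrow>qs. q\<^sup>2))"

definition CSOS :: "'n::finite rpoly \<Rightarrow> bool"
  where "CSOS p \<longleftrightarrow> convex_on UNIV (eval p) \<and> SOS p"

definition D_SOS :: "'n::finite rpoly set"
  where "D_SOS = {p. \<exists>s1 s2. SOS s1 \<and> SOS s2 \<and> p = s1 - s2}"

definition DC_SOS :: "'n::finite rpoly set"
  where "DC_SOS = {p. \<exists>s1 s2. CSOS s1 \<and> CSOS s2 \<and> p = s1 - s2}"

definition D_SOS_upto :: "nat \<Rightarrow> 'n::finite rpoly set"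
  where "D_SOS_upto d = D_SOS \<inter> polys_upto d"

definition DC_SOS_upto :: "nat \<Rightarrow> 'n::finite rpoly set"
  where "DC_SOS_upto d = DC_SOS \<inter> polys_upto d"

end

theory Submission
  imports Defs
begin

text \<open>
  The SOS and the CSOS polynomials form convex cones: a nonnegative scalar is absorbed into the
  squares through its square root, and evaluation is linear, so that convexity is inherited. The
  differences of two elements of a convex cone form a vector space.
\<close>

lemma subspace_differences:
  fixes C :: "'a::real_vector set"
  assumes zero: "0 \<in> C"
    and add: "\<And>x y. x \<in> C \<Longrightarrow> y \<in> C \<Longrightarrow> x + y \<in> C"
    and scale: "\<And>c x. 0 \<le> c \<Longrightarrow> x \<in> C \<Longrightarrow> c *\<^sub>R x \<in> C"
  shows "subspace {p. \<exists>x y. x \<in> C \<and> y \<in> C \<and> p = x - y}" (is "subspace ?D")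
  unfolding subspace_def
proof (intro conjI ballI allI)
  show "0 \<in> ?D"
    using zero by force
next
  fix p q
  assume "p \<in> ?D" "q \<in> ?D"
  then obtain x y x' y' where "x \<in> C" "y \<in> C" "x' \<in> C" "y' \<in> C" "p = x - y" "q = x' - y'"
    by blast
  then have "x + x' \<in> C" "y + y' \<in> C" "p + q = (x + x') - (y + y')"
    using add by auto
  then show "p + q \<in> ?D"
    by blast
next
  fix c p
  assume "p \<in> ?D"
  then obtain x y where C: "x \<in> C" "y \<in> C" and p: "p = x - y"
    by blast
  show "c *\<^sub>R p \<in> ?D"
  proof (cases "0 \<le> c")
    case True
    then show ?thesis
      using C p scale scaleR_diff_right by blast
  next
    case False
    \<comment> \<open>For negative \<open>c\<close> the two elements trade places:
      \<open>- c\<close> is positive, so \<open>scale\<close> applies to it. Deleting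
      \<open>scaleR_minus_left\<close> keeps the simplifier from pulling the sign out of the
      scalar.\<close>
    then have "(- c) *\<^sub>R y \<in> C" "(- c) *\<^sub>R x \<in> C"
      using C by (auto intro!: scale simp del: scaleR_minus_left)
    moreover have "c *\<^sub>R p = (- c) *\<^sub>R y - (- c) *\<^sub>R x"
      by (simp add: p algebra_simps)
    ultimately show ?thesis
      by blast
  qed
qed

text \<open>Scaling becomes multiplication by a constant polynomial, so that ring laws for powers
  and sums apply to it in \<open>SOS_scaleR\<close>.\<close>

lemma scaleR_conv_mult: "c *\<^sub>R p = Poly_Mapping.single 0 c * p"
  for p :: "'a::monoid_add \<Rightarrow>\<^sub>0 real"
  unfolding scaleR_poly_mapping_def mult_map_scale_conv_mult[symmetric]
  by (rule arg_cong[where f = "\<lambda>f. Poly_Mapping.map f p"]) (simp add: fun_eq_iff)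

lemma keys_scaleR_subset: "Poly_Mapping.keys (c *\<^sub>R p) \<subseteq> Poly_Mapping.keys p"
  by (auto simp: in_keys_iff lookup_scaleR)

text \<open>The extra monomials have coefficient 0. Cancellation or a zero scalar can shrink the
  support, so linearity of evaluation is checked over a common larger index set.\<close>

lemma eval_eq_sum:
  assumes "finite A" "Poly_Mapping.keys p \<subseteq> A"
  shows "eval p x =
    (\<Sum>m\<in>A. Poly_Mapping.lookup p m * (\<Prod>i\<in>UNIV. x $ i ^ Poly_Mapping.lookup m i))"
  unfolding eval_def using assms by (intro sum.mono_neutral_left) (auto simp: in_keys_iff)

lemma eval_zero: "eval 0 x = 0"
  by (simp add: eval_def)

lemma eval_add: "eval (p + q) x = eval p x + eval q x"
proof -
  let ?A = "Poly_Mapping.keys p \<union> Poly_Mapping.keys q"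
  have "Poly_Mapping.keys (p + q) \<subseteq> ?A"
    by (rule keys_add)
  then show ?thesis
    by (simp add: eval_eq_sum[of ?A] lookup_add sum.distrib distrib_right)
qed

lemma eval_scaleR: "eval (c *\<^sub>R p) x = c * eval p x"
  by (simp add: eval_eq_sum[OF finite_keys keys_scaleR_subset] eval_def[of p]
      lookup_scaleR sum_distrib_left mult.assoc)

lemma SOS_zero: "SOS 0"
  unfolding SOS_def by (rule exI[of _ "[]"]) simp

lemma SOS_add:
  assumes "SOS p" "SOS q"
  shows "SOS (p + q)"
proof -
  obtain ps qs where "p = (\<Sum>q\<leftarrow>ps. q\<^sup>2)" "q = (\<Sum>q\<leftarrow>qs. q\<^sup>2)"
    using assms unfolding SOS_def by blast
  then have "p + q = (\<Sum>q\<leftarrow>ps @ qs. q\<^sup>2)"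
    by simp
  then show ?thesis
    unfolding SOS_def by blast
qed

lemma SOS_scaleR:
  assumes "0 \<le> c" "SOS p"
  shows "SOS (c *\<^sub>R p)"
proof -
  obtain qs where "p = (\<Sum>q\<leftarrow>qs. q\<^sup>2)"
    using assms unfolding SOS_def by blast
  moreover have "c *\<^sub>R q\<^sup>2 = (sqrt c *\<^sub>R q)\<^sup>2" for q :: "'a rpoly"
  proof -
    have "(sqrt c *\<^sub>R q)\<^sup>2 = (Poly_Mapping.single 0 (sqrt c))\<^sup>2 * q\<^sup>2"
      by (simp add: scaleR_conv_mult power_mult_distrib)
    \<comment> \<open>Only here does the sign of \<open>c\<close> matter:
      \<open>sqrt c * sqrt c = c\<close>.\<close>
    also have "(Poly_Mapping.single 0 (sqrt c))\<^sup>2 = (Poly_Mapping.single 0 c :: 'a rpoly)"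
      using assms by (simp add: power2_eq_square mult_single)
    finally show ?thesis
      by (simp add: scaleR_conv_mult)
  qed
  ultimately have "c *\<^sub>R p = (\<Sum>q\<leftarrow>map ((*\<^sub>R) (sqrt c)) qs. q\<^sup>2)"
    by (simp add: scaleR_conv_mult sum_list_const_mult[symmetric] o_def)
  then show ?thesis
    unfolding SOS_def by blast
qed

lemma CSOS_zero: "CSOS 0"
  by (simp add: CSOS_def SOS_zero eval_zero convex_on_def)

lemma CSOS_add: "CSOS p \<Longrightarrow> CSOS q \<Longrightarrow> CSOS (p + q)"
  using convex_on_add[of UNIV "eval p" "eval q"]
  \<comment> \<open>With \<open>abs_def\<close>, \<open>eval (p + q)\<close> is rewritten as a
    function, the form in which convexity of a sum is stated.\<close>
  by (simp add: CSOS_def SOS_add eval_add[abs_def])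

lemma CSOS_scaleR: "0 \<le> c \<Longrightarrow> CSOS p \<Longrightarrow> CSOS (c *\<^sub>R p)"
  using convex_on_cmul[of c UNIV "eval p"]
  by (simp add: CSOS_def SOS_scaleR eval_scaleR[abs_def])

lemma subspace_D_SOS: "subspace D_SOS"
  unfolding D_SOS_def
  by (rule subspace_differences[of "Collect SOS", unfolded mem_Collect_eq])
    (simp_all add: SOS_zero SOS_add SOS_scaleR)

lemma subspace_DC_SOS: "subspace DC_SOS"
  unfolding DC_SOS_def
  by (rule subspace_differences[of "Collect CSOS", unfolded mem_Collect_eq])
    (simp_all add: CSOS_zero CSOS_add CSOS_scaleR)

text \<open>The degree bound is a condition on each monomial of the support, and neither sums nor
  scalar multiples create new monomials.\<close>

lemma subspace_polys_upto: "subspace (polys_upto d)"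
  unfolding subspace_def polys_upto_def
  using keys_add keys_scaleR_subset by fastforce

theorem theorem2p9:
  fixes d :: nat
  shows "subspace (D_SOS :: 'n::finite rpoly set)
    \<and> subspace (DC_SOS :: 'n rpoly set)
    \<and> subspace (polys_upto d :: 'n rpoly set)
    \<and> D_SOS_upto d \<subseteq> (polys_upto d :: 'n rpoly set) \<and> subspace (D_SOS_upto d :: 'n rpoly set)
    \<and> DC_SOS_upto d \<subseteq> (polys_upto d :: 'n rpoly set) \<and> subspace (DC_SOS_upto d :: 'n rpoly set)"
  unfolding D_SOS_upto_def DC_SOS_upto_def
  by (simp add: subspace_D_SOS subspace_DC_SOS subspace_polys_upto subspace_inter)

end
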